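(* Let $(\Omega,\mathcal{B},\mu)$ be a measure space and let $(X,X_{\mathbb{R}},\|\cdot\|_X)$ be a normed complexified space. Suppose that $\|\operatorname{Re}x\|_X\le\|x\|_X$ for all $x\in X$. Let $A:X\to L_\infty^{\mathbb{C}}(\mu)$ be a $\mathbb{C}$-linear operator satisfying $A(X_{\mathbb{R}})\subseteq L_\infty^{\mathbb{R}}(\mu)$. Then $\|A\|_{X,\infty}^{\mathbb{R}}=\|A\|_{X,\infty}^{\mathbb{C}}$.
   Context: A normed complexified space is a triple $(X,X_{\mathbb{R}},\|\cdot\|_X)$ where $X$ is a complex vector space, $X_{\mathbb{R}}$ is a real vector space, $X$ is the algebraic complexification of $X_{\mathbb{R}}$ (each $x\in X$ is uniquely $x=x_1+ix_2$ with $x_1,x_2\in X_{\mathbb{R}}$; put $\operatorname{Re}x=x_1$, $\operatorname{Im}x=x_2$), and $\|\cdot\|_X$ is a norm on the complex vector space $X$. For $\mathbb{F}=\mathbb{R}$ or $\mathbb{C}$, $L_\infty^{\mathbb{F}}(\mu)$ is the space of essentially bounded measurable functions $\Omega\to\mathbb{F}$ (identified when equal almost everywhere) with $\|y\|_\infty=\operatorname{ess\,sup}_{t\in\Omega}|y(t)|$. The operator norms, with values in $[0,\infty]$, are $$\|A\|_{X,\infty}^{\mathbb{C}}=\sup_{x\in X\setminus\{0\}}\frac{\|Ax\|_\infty}{\|x\|_X},\qquad \|A\|_{X,\infty}^{\mathbb{R}}=\sup_{x\in X_{\mathbb{R}}\setminus\{0\}}\frac{\|Ax\|_\infty}{\|x\|_X}.$$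 *)

theory Defs
  imports "HOL-Probability.Essential_Supremum"
begin

section \<open>Normed complexified spaces\<close>

text \<open>
  The complex vector space \<open>X\<close> is the whole type \<open>'a\<close> with scalar multiplication \<open>scaleC\<close>, and
  \<open>X\<^sub>\<real>\<close> is identified with its image in \<open>X\<close>: a subset closed under the operations of the underlying
  real vector space. Nonnegativity of the norm follows from the three norm axioms.
\<close>

locale normed_complexified_space = vector_space scaleC
  for scaleC :: "complex \<Rightarrow> 'a::ab_group_add \<Rightarrow> 'a" +
  fixes XR :: "'a set" and nrm :: "'a \<Rightarrow> real"
  assumes real_subspace: "module.subspace (\<lambda>r::real. scaleC (complex_of_real r)) XR"
    and complexification: "\<exists>!p. p \<in> XR \<times> XR \<and> x = fst p + scaleC \<i> (snd p)"
    and nrm_eq_0_iff: "nrm x = 0 \<longleftrightarrow> x = 0"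
    and nrm_triangle: "nrm (x + y) \<le> nrm x + nrm y"
    and nrm_scale: "nrm (scaleC c x) = cmod c * nrm x"

definition re_part :: "(complex \<Rightarrow> 'a::ab_group_add \<Rightarrow> 'a) \<Rightarrow> 'a set \<Rightarrow> 'a \<Rightarrow> 'a" where
  "re_part scaleC XR x = fst (THE p. p \<in> XR \<times> XR \<and> x = fst p + scaleC \<i> (snd p))"

definition im_part :: "(complex \<Rightarrow> 'a::ab_group_add \<Rightarrow> 'a) \<Rightarrow> 'a set \<Rightarrow> 'a \<Rightarrow> 'a" where
  "im_part scaleC XR x = snd (THE p. p \<in> XR \<times> XR \<and> x = fst p + scaleC \<i> (snd p))"

context normed_complexified_space
begin

lemma re_part_in: "re_part scaleC XR x \<in> XR"
  and im_part_in: "im_part scaleC XR x \<in> XR"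
  and re_im_part: "x = re_part scaleC XR x + scaleC \<i> (im_part scaleC XR x)"
  using theI'[OF complexification[of x]] by (auto simp: re_part_def im_part_def mem_Times_iff)

lemma re_part_eqI:
  assumes "u \<in> XR" "v \<in> XR" "x = u + scaleC \<i> v"
  shows "re_part scaleC XR x = u"
proof -
  have "(THE p. p \<in> XR \<times> XR \<and> x = fst p + scaleC \<i> (snd p)) = (u, v)"
    by (rule the1_equality[OF complexification]) (use assms in simp)
  then show ?thesis by (simp add: re_part_def)
qed

end

section \<open>The space of essentially bounded functions\<close>

text \<open>The essential supremum is taken in \<open>ennreal\<close>, so that it is \<open>0\<close> on a measure space of
  total measure zero.\<close>

definition ess_norm :: "'w measure \<Rightarrow> ('w \<Rightarrow> 'b::real_normed_field) \<Rightarrow> ennreal" where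
  "ess_norm M f = esssup M (\<lambda>t. ennreal (norm (f t)))"

definition ess_bounded :: "'w measure \<Rightarrow> ('w \<Rightarrow> 'b::real_normed_field) set" where
  "ess_bounded M = {f \<in> borel_measurable M. ess_norm M f < \<infinity>}"

definition ae_rel :: "'w measure \<Rightarrow> (('w \<Rightarrow> 'b::real_normed_field) \<times> ('w \<Rightarrow> 'b)) set" where
  "ae_rel M = {(f, g). f \<in> ess_bounded M \<and> g \<in> ess_bounded M \<and> (AE t in M. f t = g t)}"

definition Linf :: "'w measure \<Rightarrow> ('w \<Rightarrow> 'b::real_normed_field) set set" where
  "Linf M = ess_bounded M // ae_rel M"

definition Linf_add ::
    "'w measure \<Rightarrow> ('w \<Rightarrow> 'b::real_normed_field) set \<Rightarrow> ('w \<Rightarrow> 'b) set \<Rightarrow> ('w \<Rightarrow> 'b) set" where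
  "Linf_add M Y Z = (\<Union>f\<in>Y. \<Union>g\<in>Z. ae_rel M `` {\<lambda>t. f t + g t})"

definition Linf_scale ::
    "'w measure \<Rightarrow> 'b::real_normed_field \<Rightarrow> ('w \<Rightarrow> 'b) set \<Rightarrow> ('w \<Rightarrow> 'b) set" where
  "Linf_scale M c Y = (\<Union>f\<in>Y. ae_rel M `` {\<lambda>t. c * f t})"

text \<open>All representatives of a class have the same essential norm.\<close>

definition Linf_norm :: "'w measure \<Rightarrow> ('w \<Rightarrow> 'b::real_normed_field) set \<Rightarrow> ennreal" where
  "Linf_norm M Y = the_elem (ess_norm M ` Y)"

text \<open>The canonical embedding of the real \<open>L\<^sub>\<infinity>\<close> space into the complex one.\<close>

definition Linf_of_real :: "'w measure \<Rightarrow> ('w \<Rightarrow> real) set \<Rightarrow> ('w \<Rightarrow> complex) set" where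
  "Linf_of_real M Y = (\<Union>f\<in>Y. ae_rel M `` {\<lambda>t. complex_of_real (f t)})"

lemma ess_norm_cong:
  fixes f g :: "'w \<Rightarrow> 'b::real_normed_field"
  assumes "f \<in> borel_measurable M" "g \<in> borel_measurable M" "AE t in M. f t = g t"
  shows "ess_norm M f = ess_norm M g"
  unfolding ess_norm_def
proof (rule esssup_AE_cong)
  show "AE t in M. ennreal (norm (f t)) = ennreal (norm (g t))"
    using assms(3) by (rule AE_mp) auto
qed (use assms in measurable)

lemma ess_norm_add_le:
  fixes f g :: "'w \<Rightarrow> 'b::{real_normed_field, second_countable_topology}"
  assumes [measurable]: "f \<in> borel_measurable M" "g \<in> borel_measurable M"
  shows "ess_norm M (\<lambda>t. f t + g t) \<le> ess_norm M f + ess_norm M g"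
  unfolding ess_norm_def
proof (rule esssup_I)
  have "AE t in M. ennreal (norm (f t)) \<le> esssup M (\<lambda>t. ennreal (norm (f t)))"
       "AE t in M. ennreal (norm (g t)) \<le> esssup M (\<lambda>t. ennreal (norm (g t)))"
    by (rule esssup_AE)+
  then show "AE t in M. ennreal (norm (f t + g t))
      \<le> esssup M (\<lambda>t. ennreal (norm (f t))) + esssup M (\<lambda>t. ennreal (norm (g t)))"
  proof eventually_elim
    case (elim t)
    have "ennreal (norm (f t + g t)) \<le> ennreal (norm (f t)) + ennreal (norm (g t))"
      by (simp add: norm_triangle_ineq flip: ennreal_plus)
    also have "\<dots> \<le> esssup M (\<lambda>t. ennreal (norm (f t))) + esssup M (\<lambda>t. ennreal (norm (g t)))"
      using elim by (rule add_mono)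
    finally show ?case .
  qed
qed measurable

lemma ess_norm_mult_le:
  fixes f :: "'w \<Rightarrow> 'b::{real_normed_field, second_countable_topology}"
  assumes [measurable]: "f \<in> borel_measurable M"
  shows "ess_norm M (\<lambda>t. c * f t) \<le> ennreal (norm c) * ess_norm M f"
  unfolding ess_norm_def
proof (rule esssup_I)
  have "AE t in M. ennreal (norm (f t)) \<le> esssup M (\<lambda>t. ennreal (norm (f t)))"
    by (rule esssup_AE)
  then show "AE t in M. ennreal (norm (c * f t)) \<le> ennreal (norm c) * esssup M (\<lambda>t. ennreal (norm (f t)))"
    by eventually_elim (simp add: norm_mult ennreal_mult mult_left_mono)
qed measurable

lemma ess_bounded_add:
  fixes f g :: "'w \<Rightarrow> 'b::{real_normed_field, second_countable_topology}"
  shows "f \<in> ess_bounded M \<Longrightarrow> g \<in> ess_bounded M \<Longrightarrow> (\<lambda>t. f t + g t) \<in> ess_bounded M"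
  using ess_norm_add_le[of f M g] by (auto simp: ess_bounded_def intro: le_less_trans)

lemma ess_bounded_mult:
  fixes f :: "'w \<Rightarrow> 'b::{real_normed_field, second_countable_topology}"
  shows "f \<in> ess_bounded M \<Longrightarrow> (\<lambda>t. c * f t) \<in> ess_bounded M"
  using ess_norm_mult_le[of f M c]
  by (auto simp: ess_bounded_def ennreal_mult_less_top intro: le_less_trans)

lemma equiv_ae_rel: "equiv (ess_bounded M) (ae_rel M)"
  unfolding ae_rel_def
  by (intro equivI refl_onI symI transI) (auto elim: AE_mp)

lemma Linf_classI: "f \<in> ess_bounded M \<Longrightarrow> ae_rel M `` {f} \<in> Linf M"
  unfolding Linf_def by (rule quotientI)

lemma Linf_norm_class: "f \<in> ess_bounded M \<Longrightarrow> Linf_norm M (ae_rel M `` {f}) = ess_norm M f"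
proof -
  assume f: "f \<in> ess_bounded M"
  have "ess_norm M ` (ae_rel M `` {f}) = {ess_norm M f}"
  proof (intro set_eqI iffI)
    fix r assume "r \<in> {ess_norm M f}"
    then show "r \<in> ess_norm M ` (ae_rel M `` {f})"
      using f by (auto simp: ae_rel_def intro!: image_eqI[where x = f])
  qed (auto simp: ae_rel_def ess_bounded_def dest: ess_norm_cong)
  then show ?thesis by (simp add: Linf_norm_def)
qed

lemma Linf_add_class:
  fixes f g :: "'w \<Rightarrow> 'b::{real_normed_field, second_countable_topology}"
  assumes "f \<in> ess_bounded M" "g \<in> ess_bounded M"
  shows "Linf_add M (ae_rel M `` {f}) (ae_rel M `` {g}) = ae_rel M `` {\<lambda>t. f t + g t}"
  unfolding Linf_add_def
proof (rule UN_equiv_class2[OF equiv_ae_rel equiv_ae_rel _ assms])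
  show "congruent2 (ae_rel M) (ae_rel M) (\<lambda>f g. ae_rel M `` {\<lambda>t. f t + g t :: 'b})"
    by (rule congruent2I'; rule equiv_class_eq[OF equiv_ae_rel])
       (auto simp: ae_rel_def ess_bounded_add)
qed

lemma Linf_scale_class:
  fixes f :: "'w \<Rightarrow> 'b::{real_normed_field, second_countable_topology}"
  assumes "f \<in> ess_bounded M"
  shows "Linf_scale M c (ae_rel M `` {f}) = ae_rel M `` {\<lambda>t. c * f t}"
  unfolding Linf_scale_def
proof (rule UN_equiv_class[OF equiv_ae_rel _ assms])
  show "congruent (ae_rel M) (\<lambda>f. ae_rel M `` {\<lambda>t. c * f t})"
    by (rule congruentI; rule equiv_class_eq[OF equiv_ae_rel])
       (auto simp: ae_rel_def ess_bounded_mult)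
qed

lemma ess_bounded_of_real:
  "f \<in> ess_bounded M \<Longrightarrow> (\<lambda>t. complex_of_real (f t)) \<in> ess_bounded M"
  by (auto simp: ess_bounded_def ess_norm_def)

lemma Linf_of_real_class:
  assumes "f \<in> ess_bounded M"
  shows "Linf_of_real M (ae_rel M `` {f}) = ae_rel M `` {\<lambda>t. complex_of_real (f t)}"
  unfolding Linf_of_real_def
proof (rule UN_equiv_class[OF equiv_ae_rel _ assms])
  show "congruent (ae_rel M) (\<lambda>f. ae_rel M `` {\<lambda>t. complex_of_real (f t)})"
    by (rule congruentI; rule equiv_class_eq[OF equiv_ae_rel])
       (auto simp: ae_rel_def ess_bounded_of_real)
qed

section \<open>Operators and their norms\<close>

definition Linf_linear_operator ::
    "(complex \<Rightarrow> 'a::ab_group_add \<Rightarrow> 'a) \<Rightarrow> 'w measure \<Rightarrow> ('a \<Rightarrow> ('w \<Rightarrow> complex) set) \<Rightarrow> bool" where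
  "Linf_linear_operator scaleC M A \<longleftrightarrow>
     (\<forall>x. A x \<in> Linf M) \<and>
     (\<forall>x y. A (x + y) = Linf_add M (A x) (A y)) \<and>
     (\<forall>c x. A (scaleC c x) = Linf_scale M c (A x))"

text \<open>Suprema in \<open>ennreal\<close>: the norm of the operator on the zero space is \<open>0\<close>.\<close>

definition opnorm_C ::
    "('a::ab_group_add \<Rightarrow> real) \<Rightarrow> 'w measure \<Rightarrow> ('a \<Rightarrow> ('w \<Rightarrow> complex) set) \<Rightarrow> ennreal" where
  "opnorm_C nrm M A = (SUP x\<in>UNIV - {0}. Linf_norm M (A x) / ennreal (nrm x))"

definition opnorm_R ::
    "'a set \<Rightarrow> ('a::ab_group_add \<Rightarrow> real) \<Rightarrow> 'w measure \<Rightarrow> ('a \<Rightarrow> ('w \<Rightarrow> complex) set) \<Rightarrow> ennreal" where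
  "opnorm_R XR nrm M A = (SUP x\<in>XR - {0}. Linf_norm M (A x) / ennreal (nrm x))"

end

theory Submission
  imports Defs
begin

text \<open>
  Only \<open>opnorm_C \<le> opnorm_R\<close> needs an argument. Write \<open>K\<close> for the real operator norm, let \<open>x\<close> be
  any vector and let \<open>h\<close> represent \<open>A x\<close>. Since \<open>A\<close> maps \<open>XR\<close> to classes of real functions, it
  carries real parts to real parts, so for every complex \<open>c\<close> the function \<open>Re (c h)\<close> represents
  \<open>A (Re (c x))\<close>. The vector \<open>Re (c x)\<close> lies in \<open>XR\<close>, and its norm is at most \<open>\<bar>c\<bar> \<parallel>x\<parallel>\<close> by the
  hypothesis on real parts; therefore \<open>\<bar>Re (c h)\<bar> \<le> \<bar>c\<bar> K \<parallel>x\<parallel>\<close> almost everywhere.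

  At a point \<open>t\<close> the choice \<open>c = cnj (h t)\<close> would turn this into \<open>\<bar>h t\<bar> \<le> K \<parallel>x\<parallel>\<close>. However, the
  exceptional null set depends on \<open>c\<close>, and uncountably many values of \<open>c\<close> would be needed. So \<open>c\<close>
  first runs only through a countable dense set of complex numbers, which leaves a single null
  set, and outside of it both sides are continuous in \<open>c\<close>. This passage is
  \<open>ess_norm_le_of_rotated_Re\<close>; the compatibility with real parts is \<open>operator_re_part\<close>.
\<close>

lemma ess_norm_le_iff:
  fixes f :: "'w \<Rightarrow> 'b::real_normed_field"
  assumes "f \<in> borel_measurable M"
  shows "ess_norm M f \<le> B \<longleftrightarrow> (AE t in M. ennreal (norm (f t)) \<le> B)"
proof
  assume le: "ess_norm M f \<le> B"
  have "AE t in M. ennreal (norm (f t)) \<le> ess_norm M f"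
    unfolding ess_norm_def by (rule esssup_AE)
  then show "AE t in M. ennreal (norm (f t)) \<le> B"
    by eventually_elim (rule order_trans[OF _ le])
next
  assume "AE t in M. ennreal (norm (f t)) \<le> B"
  then show "ess_norm M f \<le> B"
    unfolding ess_norm_def by (intro esssup_I) (use assms in measurable)
qed

text \<open>
  A closed condition on \<open>c\<close> that holds on a dense set holds everywhere, in particular at the
  conjugate of \<open>w\<close>, where \<open>Re (c * w)\<close> is the square of the modulus of \<open>w\<close>.
\<close>

lemma cmod_le_of_dense_Re:
  assumes dense: "closure D = UNIV" and b: "0 \<le> b"
    and le: "\<And>c. c \<in> D \<Longrightarrow> \<bar>Re (c * w)\<bar> \<le> cmod c * b"
  shows "cmod w \<le> b"
proof -
  have "closed {c. \<bar>Re (c * w)\<bar> \<le> cmod c * b}"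
    by (intro closed_Collect_le continuous_intros)
  then have "closure D \<subseteq> {c. \<bar>Re (c * w)\<bar> \<le> cmod c * b}"
    by (intro closure_minimal) (use le in auto)
  then have "\<bar>Re (cnj w * w)\<bar> \<le> cmod (cnj w) * b"
    using dense by blast
  moreover have "cnj w * w = complex_of_real ((cmod w)\<^sup>2)"
    using complex_norm_square[of w] by (simp add: mult.commute)
  ultimately have "cmod w * cmod w \<le> cmod w * b"
    by (simp add: power2_eq_square)
  then show ?thesis
    using b by (cases "w = 0") auto
qed

text \<open>
  Restricting \<open>c\<close> to a countable dense set is what allows the quantifiers "for every \<open>c\<close>" and
  "almost everywhere" to be interchanged.
\<close>

lemma ess_norm_le_of_rotated_Re:
  fixes h :: "'w \<Rightarrow> complex"
  assumes [measurable]: "h \<in> borel_measurable M"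
    and le: "\<And>c. ess_norm M (\<lambda>t. Re (c * h t)) \<le> ennreal (cmod c) * B"
  shows "ess_norm M h \<le> B"
proof (cases B)
  case (real b)
  obtain D :: "complex set" where D: "countable D" "closure D = UNIV"
  proof -
    obtain D :: "complex set" where D: "countable D" "\<And>U. open U \<Longrightarrow> U \<noteq> {} \<Longrightarrow> \<exists>d\<in>D. d \<in> U"
      by (rule countable_dense_setE) blast
    have "- closure D = {}"
      using D(2)[of "- closure D"] closure_subset[of D] by auto
    then show thesis
      using that D(1) by blast
  qed
  have "AE t in M. \<bar>Re (c * h t)\<bar> \<le> cmod c * b" for c
  proof -
    have "AE t in M. ennreal (norm (Re (c * h t))) \<le> ennreal (cmod c) * B"
      using le[of c] by (subst (asm) ess_norm_le_iff) measurable
    then show ?thesis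
      using real by (simp flip: ennreal_mult)
  qed
  then have "AE t in M. \<forall>c\<in>D. \<bar>Re (c * h t)\<bar> \<le> cmod c * b"
    using D by (simp add: AE_ball_countable)
  then have "AE t in M. ennreal (cmod (h t)) \<le> B"
    by eventually_elim (use real D in \<open>auto intro!: ennreal_leI cmod_le_of_dense_Re\<close>)
  then show ?thesis
    by (simp add: ess_norm_le_iff)
qed simp

lemma Linf_repr:
  assumes "Y \<in> Linf M"
  obtains f where "f \<in> ess_bounded M" "Y = ae_rel M `` {f}"
  using assms by (auto simp: Linf_def elim: quotientE)

lemma ae_rel_class_eqD:
  assumes "ae_rel M `` {f} = ae_rel M `` {g}" "g \<in> ess_bounded M"
  shows "AE t in M. f t = g t"
  using eq_equiv_class[OF assms(1) equiv_ae_rel assms(2)] by (simp add: ae_rel_def)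

context normed_complexified_space
begin

lemma nrm_zero: "nrm 0 = 0"
  by (simp add: nrm_eq_0_iff)

lemma nrm_nonneg: "0 \<le> nrm x"
proof -
  have "nrm (- x) = nrm x"
    using nrm_scale[of "-1" x] by simp
  then show ?thesis
    using nrm_triangle[of x "- x"] by (simp add: nrm_zero)
qed

text \<open>
  Splitting \<open>y = u + \<i> v\<close> with \<open>u, v \<in> XR\<close> gives \<open>A y = [f + \<i> g]\<close> with \<open>f\<close> and \<open>g\<close> real, so
  the class \<open>A u = [f]\<close> is determined by the real part of any representative of \<open>A y\<close>.
\<close>

lemma operator_re_part:
  assumes lin: "Linf_linear_operator scaleC M A"
    and real: "A ` XR \<subseteq> Linf_of_real M ` Linf M"
    and k: "k \<in> ess_bounded M" "A y = ae_rel M `` {k}"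
  obtains f where "f \<in> ess_bounded M" "AE t in M. f t = Re (k t)"
    "A (re_part scaleC XR y) = ae_rel M `` {\<lambda>t. complex_of_real (f t)}"
proof -
  define u where "u = re_part scaleC XR y"
  define v where "v = im_part scaleC XR y"
  have uv: "u \<in> XR" "v \<in> XR" "y = u + scaleC \<i> v"
    unfolding u_def v_def by (rule re_part_in im_part_in re_im_part)+
  have repr: "\<exists>f\<in>ess_bounded M. A z = ae_rel M `` {\<lambda>t. complex_of_real (f t)}"
    if "z \<in> XR" for z
    using real that by (force elim!: Linf_repr simp: Linf_of_real_class)
  from repr uv obtain f g where
      f: "f \<in> ess_bounded M" "A u = ae_rel M `` {\<lambda>t. complex_of_real (f t)}" and
      g: "g \<in> ess_bounded M" "A v = ae_rel M `` {\<lambda>t. complex_of_real (g t)}"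
    by metis
  have "A y = Linf_add M (A u) (Linf_scale M \<i> (A v))"
    using lin uv(3) by (simp add: Linf_linear_operator_def)
  also have "\<dots> = ae_rel M `` {\<lambda>t. complex_of_real (f t) + \<i> * complex_of_real (g t)}"
    using f g
    by (simp add: Linf_scale_class Linf_add_class ess_bounded_of_real ess_bounded_mult)
  finally have "AE t in M. complex_of_real (f t) + \<i> * complex_of_real (g t) = k t"
    using k by (intro ae_rel_class_eqD) auto
  then have "AE t in M. f t = Re (k t)"
    by eventually_elim (auto dest: arg_cong[where f = Re])
  then show thesis
    using that f by (simp add: u_def)
qed

lemma Linf_norm_le_opnorm_R:
  assumes lin: "Linf_linear_operator scaleC M A" and z: "z \<in> XR"
  shows "Linf_norm M (A z) \<le> opnorm_R XR nrm M A * ennreal (nrm z)"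
proof (cases "z = 0")
  case True
  obtain f where f: "f \<in> ess_bounded M" "A 0 = ae_rel M `` {f}"
    using lin unfolding Linf_linear_operator_def by (meson Linf_repr)
  \<comment> \<open>The supremum \<open>opnorm_R\<close> omits \<open>z = 0\<close>; there homogeneity gives norm \<open>0\<close>.\<close>
  have "A 0 = Linf_scale M 0 (A 0)"
    using lin by (metis Linf_linear_operator_def scale_zero_right)
  then have "A 0 = ae_rel M `` {\<lambda>t. 0 * f t}"
    using f by (simp only: Linf_scale_class)
  then have "Linf_norm M (A 0) = ess_norm M (\<lambda>t. 0 * f t)"
    using f by (simp only: Linf_norm_class ess_bounded_mult)
  also have "\<dots> \<le> 0"
    using ess_norm_mult_le[of f M 0] f by (simp add: ess_bounded_def)
  finally show ?thesis
    using True by simp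
next
  case False
  then have pos: "0 < nrm z"
    using nrm_nonneg[of z] nrm_eq_0_iff[of z] by linarith
  have "Linf_norm M (A z) / ennreal (nrm z) \<le> opnorm_R XR nrm M A"
    unfolding opnorm_R_def by (rule SUP_upper) (use z False in simp)
  then have "Linf_norm M (A z) / ennreal (nrm z) * ennreal (nrm z)
      \<le> opnorm_R XR nrm M A * ennreal (nrm z)"
    by (rule mult_right_mono) simp
  then show ?thesis
    using pos by (simp add: ennreal_divide_times mult_divide_eq_ennreal)
qed

text \<open>
  The real bound is applied to \<open>Re (c x)\<close> for every complex \<open>c\<close>: the factors \<open>c\<close> reach all
  directions of the values of \<open>A x\<close> in the plane, so no constant such as the \<open>2\<close> from estimating
  real and imaginary part separately is lost.
\<close>

lemma Linf_norm_le_opnorm_R_complex: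
  assumes re: "\<And>x. nrm (re_part scaleC XR x) \<le> nrm x"
    and lin: "Linf_linear_operator scaleC M A"
    and real: "A ` XR \<subseteq> Linf_of_real M ` Linf M"
  shows "Linf_norm M (A x) \<le> opnorm_R XR nrm M A * ennreal (nrm x)"
proof -
  let ?K = "opnorm_R XR nrm M A"
  obtain h where h: "h \<in> ess_bounded M" "A x = ae_rel M `` {h}"
    using lin unfolding Linf_linear_operator_def by (meson Linf_repr)
  have h_meas [measurable]: "h \<in> borel_measurable M"
    using h by (simp add: ess_bounded_def)
  have "ess_norm M (\<lambda>t. Re (c * h t)) \<le> ennreal (cmod c) * (?K * ennreal (nrm x))" for c
  proof -
    let ?z = "re_part scaleC XR (scaleC c x)"
    have "A (scaleC c x) = ae_rel M `` {\<lambda>t. c * h t}"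
      using lin h by (simp add: Linf_linear_operator_def Linf_scale_class)
    then obtain f where f: "f \<in> ess_bounded M" "AE t in M. f t = Re (c * h t)"
        "A ?z = ae_rel M `` {\<lambda>t. complex_of_real (f t)}"
      using operator_re_part[OF lin real ess_bounded_mult[OF h(1)]] by blast
    have [measurable]: "f \<in> borel_measurable M"
      using f by (simp add: ess_bounded_def)
    have "ess_norm M (\<lambda>t. Re (c * h t)) = ess_norm M f"
      by (rule ess_norm_cong) (use f(2) in \<open>auto elim: AE_mp\<close>)
    also have "\<dots> = ess_norm M (\<lambda>t. complex_of_real (f t))"
      by (simp add: ess_norm_def)
    also have "\<dots> = Linf_norm M (A ?z)"
      using f by (simp add: Linf_norm_class ess_bounded_of_real)
    also have "\<dots> \<le> ?K * ennreal (nrm ?z)"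
      using lin re_part_in by (rule Linf_norm_le_opnorm_R)
    also have "\<dots> \<le> ?K * ennreal (cmod c * nrm x)"
      using re[of "scaleC c x"] by (intro mult_left_mono ennreal_leI) (auto simp: nrm_scale)
    also have "\<dots> = ennreal (cmod c) * (?K * ennreal (nrm x))"
      by (simp add: ennreal_mult nrm_nonneg mult_ac)
    finally show ?thesis .
  qed
  then have "ess_norm M h \<le> ?K * ennreal (nrm x)"
    by (rule ess_norm_le_of_rotated_Re[OF h_meas])
  then show ?thesis
    using h by (simp add: Linf_norm_class)
qed

end

theorem theorem3p5:
  fixes M :: "'w measure"
    and scaleC :: "complex \<Rightarrow> 'a::ab_group_add \<Rightarrow> 'a"
    and XR :: "'a set"
    and nrm :: "'a \<Rightarrow> real"
    and A :: "'a \<Rightarrow> ('w \<Rightarrow> complex) set"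
  assumes "normed_complexified_space scaleC XR nrm"
    and "\<And>x. nrm (re_part scaleC XR x) \<le> nrm x"
    and "Linf_linear_operator scaleC M A"
    and "A ` XR \<subseteq> Linf_of_real M ` Linf M"
  shows "opnorm_R XR nrm M A = opnorm_C nrm M A"
proof (rule antisym)
  show "opnorm_R XR nrm M A \<le> opnorm_C nrm M A"
    unfolding opnorm_R_def opnorm_C_def by (rule SUP_subset_mono) auto
next
  interpret normed_complexified_space scaleC XR nrm by fact
  show "opnorm_C nrm M A \<le> opnorm_R XR nrm M A"
    unfolding opnorm_C_def
  proof (rule SUP_least)
    fix x :: 'a assume "x \<in> UNIV - {0}"
    then have "0 < ennreal (nrm x)"
      using nrm_nonneg[of x] nrm_eq_0_iff[of x] by (simp add: less_le)
    moreover have "Linf_norm M (A x) \<le> ennreal (nrm x) * opnorm_R XR nrm M A"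
      using Linf_norm_le_opnorm_R_complex[OF assms(2-4)] by (simp add: mult.commute)
    ultimately show "Linf_norm M (A x) / ennreal (nrm x) \<le> opnorm_R XR nrm M A"
      by (rule divide_le_posI_ennreal)
  qed
qed

end
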